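(* Let $p$ be a prime number, let $G$ be a finite $p$-group and let $a\in G$. Assume that $|\operatorname{Cl}(a)|=p^n$. Then the product $\operatorname{Cl}(a)\operatorname{Cl}(a^{-1})$ of the conjugacy class of $a$ in $G$ and the conjugacy class of $a^{-1}$ in $G$ is the union of at least $n(p-1)+1$ distinct conjugacy classes of $G$, i.e. $\eta(\operatorname{Cl}(a)\operatorname{Cl}(a^{-1}))\geq n(p-1)+1$.
   Context: For a finite group $G$ and $a\in G$, $\operatorname{Cl}(a)=\{gag^{-1}\mid g\in G\}$ is the conjugacy class of $a$ in $G$. For subsets $X,Y$ of $G$, $XY=\{xy\mid x\in X, y\in Y\}$. If a subset $X$ of $G$ is $G$-invariant (stable under conjugation by all elements of $G$), then $X$ is a union of $m$ distinct conjugacy classes of $G$ for some integer $m$, and $\eta(X)=m$ denotes this number. A product of two conjugacy classes is $G$-invariant. *)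

theory Defs
  imports "HOL-Algebra.Coset" "HOL-Computational_Algebra.Primes"
begin

definition conj_class :: "('a, 'b) monoid_scheme \<Rightarrow> 'a \<Rightarrow> 'a set" where
  "conj_class G a = {g \<otimes>\<^bsub>G\<^esub> a \<otimes>\<^bsub>G\<^esub> inv\<^bsub>G\<^esub> g | g. g \<in> carrier G}"

definition conj_classes :: "('a, 'b) monoid_scheme \<Rightarrow> 'a set set" where
  "conj_classes G = conj_class G ` carrier G"

definition conj_invariant :: "('a, 'b) monoid_scheme \<Rightarrow> 'a set \<Rightarrow> bool" where
  "conj_invariant G X \<longleftrightarrow>
     X \<subseteq> carrier G \<and> (\<forall>g \<in> carrier G. \<forall>x \<in> X. g \<otimes>\<^bsub>G\<^esub> x \<otimes>\<^bsub>G\<^esub> inv\<^bsub>G\<^esub> g \<in> X)"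

text \<open>For a conjugation-invariant \<open>X\<close>, the classes contained in \<open>X\<close> are exactly
  the distinct classes whose union is \<open>X\<close>; see \<open>conj_invariant_eq_Union\<close> and
  \<open>eta_Union\<close> below. In an infinite group, \<open>eta G X\<close> is 0 if \<open>X\<close> contains
  infinitely many classes.\<close>

definition eta :: "('a, 'b) monoid_scheme \<Rightarrow> 'a set \<Rightarrow> nat" where
  "eta G X = card {C \<in> conj_classes G. C \<subseteq> X}"

context group
begin

lemma conj_class_self: "a \<in> carrier G \<Longrightarrow> a \<in> conj_class G a"
  by (subst conj_class_def) (rule CollectI, rule exI[of _ \<one>], simp)

lemma conj_conj:
  assumes "g \<in> carrier G" "h \<in> carrier G" "a \<in> carrier G"
  shows "g \<otimes> (h \<otimes> a \<otimes> inv h) \<otimes> inv g = (g \<otimes> h) \<otimes> a \<otimes> inv (g \<otimes> h)"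
  using assms by (simp add: inv_mult_group m_assoc)

lemma conj_class_subset:
  assumes a: "a \<in> carrier G" and b: "b \<in> conj_class G a"
  shows "conj_class G b \<subseteq> conj_class G a"
proof
  fix x assume "x \<in> conj_class G b"
  then obtain g where g: "g \<in> carrier G" "x = g \<otimes> b \<otimes> inv g"
    by (auto simp: conj_class_def)
  obtain h where h: "h \<in> carrier G" "b = h \<otimes> a \<otimes> inv h"
    using b by (auto simp: conj_class_def)
  have "x = (g \<otimes> h) \<otimes> a \<otimes> inv (g \<otimes> h)"
    using g h a conj_conj by simp
  thus "x \<in> conj_class G a"
    using g h unfolding conj_class_def by blast
qed

lemma conj_class_eq:
  assumes a: "a \<in> carrier G" and b: "b \<in> conj_class G a"
  shows "conj_class G b = conj_class G a"
proof
  show "conj_class G b \<subseteq> conj_class G a" using assms by (rule conj_class_subset)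
  obtain h where h: "h \<in> carrier G" "b = h \<otimes> a \<otimes> inv h"
    using b by (auto simp: conj_class_def)
  have bc: "b \<in> carrier G" using h a by simp
  have "a = inv h \<otimes> b \<otimes> inv (inv h)"
    using conj_conj[of "inv h" h a] h a by simp
  hence "a \<in> conj_class G b"
    using inv_closed[OF h(1)] unfolding conj_class_def by blast
  thus "conj_class G a \<subseteq> conj_class G b" by (rule conj_class_subset[OF bc])
qed

lemma conj_invariant_eq_Union:
  assumes "conj_invariant G X"
  shows "X = \<Union>{C \<in> conj_classes G. C \<subseteq> X}"
proof
  show "X \<subseteq> \<Union>{C \<in> conj_classes G. C \<subseteq> X}"
  proof
    fix x assume x: "x \<in> X"
    hence xc: "x \<in> carrier G" using assms by (auto simp: conj_invariant_def)
    have "conj_class G x \<subseteq> X"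
      using assms x by (auto simp: conj_invariant_def conj_class_def)
    thus "x \<in> \<Union>{C \<in> conj_classes G. C \<subseteq> X}"
      using conj_class_self[OF xc] xc by (auto simp: conj_classes_def)
  qed
qed auto

lemma eta_Union:
  assumes "S \<subseteq> conj_classes G"
  shows "eta G (\<Union>S) = card S"
proof -
  have "C \<in> S" if C: "C \<in> conj_classes G" "C \<subseteq> \<Union>S" for C
  proof -
    obtain a where a: "a \<in> carrier G" "C = conj_class G a"
      using C by (auto simp: conj_classes_def)
    obtain D where D: "D \<in> S" "a \<in> D" using C a conj_class_self by blast
    obtain d where d: "d \<in> carrier G" "D = conj_class G d"
      using D assms by (auto simp: conj_classes_def)
    have "C = D" using conj_class_eq[of d a] a d D by simp
    thus ?thesis using D by simp
  qed
  hence "{C \<in> conj_classes G. C \<subseteq> \<Union>S} = S" using assms by blast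
  thus ?thesis by (simp add: eta_def)
qed

lemma conj_invariant_mult_conj_class:
  assumes a: "a \<in> carrier G" and b: "b \<in> carrier G"
  shows "conj_invariant G (conj_class G a <#> conj_class G b)"
  unfolding conj_invariant_def
proof (intro conjI ballI)
  show "conj_class G a <#> conj_class G b \<subseteq> carrier G"
    using assms by (auto simp: set_mult_def conj_class_def)
next
  fix g z assume g: "g \<in> carrier G" and "z \<in> conj_class G a <#> conj_class G b"
  then obtain h k where h: "h \<in> carrier G" and k: "k \<in> carrier G"
    and z: "z = (h \<otimes> a \<otimes> inv h) \<otimes> (k \<otimes> b \<otimes> inv k)"
    by (auto simp: set_mult_def conj_class_def)
  let ?x = "h \<otimes> a \<otimes> inv h" and ?y = "k \<otimes> b \<otimes> inv k"
  have xy: "?x \<in> carrier G" "?y \<in> carrier G" using h k a b by auto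
  have "g \<otimes> (?x \<otimes> ?y) \<otimes> inv g = (g \<otimes> ?x \<otimes> inv g) \<otimes> (g \<otimes> ?y \<otimes> inv g)"
  proof -
    have "inv g \<otimes> (g \<otimes> (?y \<otimes> inv g)) = ?y \<otimes> inv g"
      using g xy(2) by (simp only: m_assoc[symmetric] m_closed inv_closed l_inv l_one)
    thus ?thesis using g xy by (simp only: m_assoc m_closed inv_closed)
  qed
  also have "\<dots> = ((g \<otimes> h) \<otimes> a \<otimes> inv (g \<otimes> h)) \<otimes> ((g \<otimes> k) \<otimes> b \<otimes> inv (g \<otimes> k))"
    using conj_conj[OF g h a] conj_conj[OF g k b] by simp
  also have "\<dots> \<in> conj_class G a <#> conj_class G b"
  proof -
    have "u \<otimes> c \<otimes> inv u \<in> conj_class G c" if "u \<in> carrier G" for u c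
      using that by (auto simp: conj_class_def)
    hence "(g \<otimes> h) \<otimes> a \<otimes> inv (g \<otimes> h) \<in> conj_class G a"
      "(g \<otimes> k) \<otimes> b \<otimes> inv (g \<otimes> k) \<in> conj_class G b"
      using g h k by simp_all
    thus ?thesis unfolding set_mult_def by blast
  qed
  finally show "g \<otimes> z \<otimes> inv g \<in> conj_class G a <#> conj_class G b" using z by simp
qed

end

end

theory Submission
  imports Defs "HOL-Algebra.Group_Action" "HOL-Algebra.Multiplicative_Group"
    "HOL-Algebra.Weak_Morphisms"
begin

text \<open>The bound follows by induction on the order of \<open>G\<close>, by dividing out a central subgroup
  \<open>Z\<close> of prime order \<open>p\<close>. Write \<open>H = G / Z\<close>, let \<open>b\<close> be the image of \<open>a\<close>, and let
  \<open>P = Cl(a) Cl(a\<inverse>)\<close>, which is mapped onto \<open>Cl(b) Cl(b\<inverse>)\<close>. Since \<open>Z\<close> is central, the elements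
  \<open>z\<close> of \<open>Z\<close> with \<open>z a \<in> Cl(a)\<close> form a subgroup \<open>T\<close> of \<open>Z\<close>, and each fibre of \<open>Cl(a) \<rightarrow> Cl(b)\<close>
  is a translate of \<open>T\<close>; so \<open>|Cl(a)| = |T| |Cl(b)|\<close>
  (\<open>card_conj_class_of_kernel_translations\<close>). As \<open>p\<close> is prime, \<open>T\<close> is \<open>1\<close> or \<open>Z\<close>.

  If \<open>T = 1\<close>, then \<open>Cl(b)\<close> has the same size as \<open>Cl(a)\<close>, and \<open>P\<close> has at least as many classes as
  its image, so the bound for \<open>H\<close> is enough. If \<open>T = Z\<close>, then \<open>n\<close> drops by one, but \<open>P\<close> contains
  \<open>Z\<close>, because \<open>z = (z a) a\<inverse>\<close>. The \<open>p\<close> elements of \<open>Z\<close> are \<open>p\<close> distinct classes of \<open>P\<close> that all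
  collapse to the class of the identity in \<open>H\<close>, so at least \<open>p - 1\<close> classes are gained
  (\<open>eta_image_le\<close>), exactly what the bound demands. The two cases are treated together in
  \<open>eta_lower_bound_lift\<close>.\<close>

section \<open>Central elements of finite p-groups\<close>

lemma prime_dvd_of_dvd_prime_power:
  fixes p m :: nat
  assumes "prime p" "m dvd p ^ k" "m \<noteq> 1"
  shows "p dvd m"
proof -
  obtain i where "m = p ^ i" using assms(1,2) by (auto simp: divides_primepow_nat)
  thus ?thesis using assms(3) by (cases i) auto
qed

context group
begin

lemma orbit_conjugation_eq_conj_class:
  assumes "a \<in> carrier G"
  shows "orbit G (\<lambda>g. \<lambda>h\<in>carrier G. g \<otimes> h \<otimes> inv g) a = conj_class G a"
  using assms by (auto simp: orbit_def conj_class_def)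

lemma card_conj_class_dvd_order:
  assumes "a \<in> carrier G"
  shows "card (conj_class G a) dvd order G"
  by (rule dvdI[OF group_action.orbit_stabilizer_theorem[OF action_by_conjugation assms,
      unfolded orbit_conjugation_eq_conj_class[OF assms], symmetric]])

lemma conj_class_in_carrier: "a \<in> carrier G \<Longrightarrow> conj_class G a \<subseteq> carrier G"
  by (auto simp: conj_class_def)

lemma conj_class_closed:
  assumes "a \<in> carrier G" "x \<in> conj_class G a" "g \<in> carrier G"
  shows "g \<otimes> x \<otimes> inv g \<in> conj_class G a"
  using conj_class_subset[OF assms(1,2)] assms(3) unfolding conj_class_def by blast

lemma conj_class_central:
  assumes "z \<in> carrier G" "\<And>g. g \<in> carrier G \<Longrightarrow> g \<otimes> z = z \<otimes> g"
  shows "conj_class G z = {z}"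
proof -
  have "g \<otimes> z \<otimes> inv g = z" if "g \<in> carrier G" for g
    using assms that by (simp add: m_assoc)
  thus ?thesis
    using conj_class_self[OF assms(1)] by (force simp: conj_class_def)
qed

lemma conj_class_one: "conj_class G \<one> = {\<one>}"
  by (rule conj_class_central) auto

lemma order_eq_sum_conj_classes:
  assumes "finite (carrier G)"
  shows "order G = (\<Sum>C\<in>conj_classes G. card C)"
proof -
  have "conj_classes G = orbits G (carrier G) (\<lambda>g. \<lambda>h\<in>carrier G. g \<otimes> h \<otimes> inv g)"
    using orbit_conjugation_eq_conj_class by (force simp: orbits_def conj_classes_def)
  thus ?thesis
    using group_action.disjoint_sum[OF action_by_conjugation assms, of "\<lambda>_. 1::nat"]
    by (simp add: order_def)
qed

text \<open>By the class equation: if every class except the class of \<open>\<one>\<close> had more than one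
  element, its size would be divisible by \<open>p\<close>, and so \<open>p\<close> would divide \<open>1\<close>.\<close>

lemma prime_power_order_imp_nontrivial_center:
  assumes p: "prime p" and ord: "order G = p ^ Suc k"
  shows "\<exists>z\<in>carrier G. z \<noteq> \<one> \<and> (\<forall>g\<in>carrier G. g \<otimes> z = z \<otimes> g)"
proof (rule ccontr)
  assume contra: "\<not> ?thesis"
  have fin: "finite (carrier G)"
    using ord p order_gt_0_iff_finite prime_gt_0_nat by simp
  have dvd: "p dvd card C" if C: "C \<in> conj_classes G - {{\<one>}}" for C
  proof -
    obtain a where a: "a \<in> carrier G" "C = conj_class G a"
      using C by (auto simp: conj_classes_def)
    hence "a \<noteq> \<one>" using C conj_class_one by auto
    then obtain g where g: "g \<in> carrier G" "g \<otimes> a \<noteq> a \<otimes> g" using contra a by blast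
    have "g \<otimes> a \<otimes> inv g \<noteq> a"
      using g a by (metis inv_solve_right m_closed)
    hence "{a, g \<otimes> a \<otimes> inv g} \<subseteq> C" "card {a, g \<otimes> a \<otimes> inv g} = 2"
      using conj_class_self[OF a(1)] conj_class_closed[OF a(1) _ g(1)] a(2) by auto
    moreover have "finite C"
      using finite_subset[OF conj_class_in_carrier[OF a(1)] fin] a(2) by simp
    ultimately have "2 \<le> card C" by (metis card_mono)
    hence "card C \<noteq> 1" by simp
    moreover have "card C dvd p ^ Suc k"
      using card_conj_class_dvd_order[OF a(1)] a(2) ord by simp
    ultimately show ?thesis using prime_dvd_of_dvd_prime_power[OF p] by blast
  qed
  have "{\<one>} \<in> conj_classes G"
    unfolding conj_classes_def using conj_class_one by (metis image_eqI one_closed)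
  moreover have "finite (conj_classes G)" using fin by (simp add: conj_classes_def)
  ultimately have "order G = 1 + (\<Sum>C\<in>conj_classes G - {{\<one>}}. card C)"
    using order_eq_sum_conj_classes[OF fin] by (subst (asm) sum.remove[of _ "{\<one>}"]) auto
  moreover have "p dvd (\<Sum>C\<in>conj_classes G - {{\<one>}}. card C)"
    using dvd by (intro dvd_sum) auto
  moreover have "p dvd order G" using ord by simp
  ultimately have "p dvd 1" using dvd_add_left_iff[of p _ 1] by metis
  thus False using p by simp
qed

lemma ex_central_subgroup_of_prime_order:
  assumes p: "prime p" and ord: "order G = p ^ Suc k"
  shows "\<exists>Z. subgroup Z G \<and> card Z = p \<and> (\<forall>z\<in>Z. \<forall>g\<in>carrier G. g \<otimes> z = z \<otimes> g)"
proof -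
  obtain y where y: "y \<in> carrier G" "y \<noteq> \<one>" "\<forall>g\<in>carrier G. g \<otimes> y = y \<otimes> g"
    using prime_power_order_imp_nontrivial_center[OF assms] by blast
  have fin: "finite (carrier G)"
    using ord p order_gt_0_iff_finite prime_gt_0_nat by simp
  have "group.ord G y dvd p ^ Suc k" using ord_dvd_group_order[OF y(1)] ord by simp
  moreover have "group.ord G y \<noteq> 1" using y ord_eq_1 by simp
  ultimately have pdvd: "p dvd group.ord G y"
    using prime_dvd_of_dvd_prime_power[OF p] by blast
  \<comment> \<open>A suitable power of a nontrivial central element has order exactly \<open>p\<close>.\<close>
  define q where "q = group.ord G y div p"
  have opos: "group.ord G y > 0" using ord_ge_1[OF fin y(1)] by simp
  have q: "group.ord G y = q * p" using pdvd by (simp add: q_def)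
  hence q0: "q \<noteq> 0" using opos by auto
  define z where "z = y [^] q"
  have zc: "z \<in> carrier G" using y by (simp add: z_def)
  have zord: "group.ord G z = p"
    unfolding z_def using ord_pow[OF y(1), of q] q q0 by simp
  have com: "g \<otimes> (y [^] (m::nat)) = y [^] m \<otimes> g" if "g \<in> carrier G" for g m
  proof (induction m)
    case (Suc m)
    have "g \<otimes> (y [^] Suc m) = (g \<otimes> y [^] m) \<otimes> y" using that y(1) by (simp add: m_assoc)
    also have "\<dots> = y [^] m \<otimes> (g \<otimes> y)" unfolding Suc using that y(1) by (simp add: m_assoc)
    also have "\<dots> = y [^] m \<otimes> (y \<otimes> g)" by (simp only: y(3)[rule_format, OF that])
    also have "\<dots> = y [^] Suc m \<otimes> g" using that y(1) by (simp add: m_assoc)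
    finally show ?case .
  qed (use that in simp)
  have "subgroup (generate G {z}) G" using zc by (intro generate_is_subgroup) auto
  moreover have "card (generate G {z}) = p" using generate_pow_card[OF zc] zord by simp
  moreover have "g \<otimes> x = x \<otimes> g" if x: "x \<in> generate G {z}" "g \<in> carrier G" for x g
  proof -
    obtain m :: nat where "x = z [^] m"
      using x(1) unfolding generate_pow_on_finite_carrier[OF fin zc] by blast
    hence "x = y [^] (q * m)" using y(1) by (simp add: z_def nat_pow_pow)
    thus ?thesis using com[OF x(2), of "q * m"] by simp
  qed
  ultimately show ?thesis by blast
qed

text \<open>The elements of \<open>G Mod Z\<close> are sets of elements of \<open>G\<close>, so an induction in which the group
  varies over a fixed type cannot pass to it. Replacing each coset by a chosen representative
  gives an isomorphic group on the type of \<open>G\<close> itself.\<close>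

lemma ex_quotient_on_same_type:
  assumes Z: "Z \<lhd> G"
  obtains H :: "'a monoid" and h
  where "group_hom G H h" "h ` carrier G = carrier H" "kernel G H h = Z"
proof -
  interpret Z: normal Z G by fact
  define h where "h x = (SOME y. y \<in> Z #> x)" for x
  have hin: "h x \<in> Z #> x" if "x \<in> carrier G" for x
    unfolding h_def using rcos_self[OF that Z.subgroup_axioms] by (rule someI)
  have "weak_group_morphism h Z G"
  proof (rule weak_group_morphismsI[OF Z])
    fix a b assume ab: "a \<in> carrier G" "b \<in> carrier G"
    have coset: "Z #> x = Z #> y" if "y \<in> Z #> x" "x \<in> carrier G" for x y
      by (rule repr_independence[OF that Z.subgroup_axioms])
    have "h a = h b \<longleftrightarrow> Z #> a = Z #> b"
    proof
      assume eq: "h a = h b"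
      have "Z #> a = Z #> h a" by (rule coset[OF hin[OF ab(1)] ab(1)])
      also have "\<dots> = Z #> h b" by (rule arg_cong[OF eq])
      also have "\<dots> = Z #> b" by (rule coset[OF hin[OF ab(2)] ab(2), symmetric])
      finally show "Z #> a = Z #> b" .
    qed (simp only: h_def)
    also have "\<dots> \<longleftrightarrow> a \<in> Z #> b"
    proof
      assume "Z #> a = Z #> b"
      thus "a \<in> Z #> b" using rcos_self[OF ab(1) Z.subgroup_axioms] by simp
    next
      assume "a \<in> Z #> b"
      thus "Z #> a = Z #> b" by (rule coset[OF _ ab(2), symmetric])
    qed
    also have "\<dots> \<longleftrightarrow> a \<otimes> inv b \<in> Z"
      using ab Z.rcos_module[OF group_axioms] by blast
    finally show "h a = h b \<longleftrightarrow> a \<otimes> inv b \<in> Z" .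
  qed
  note weak_group_morphism_group_hom[OF this] weak_group_morphism_ker[OF this]
  thus thesis
    by (intro that[of "image_group h G" h]) (simp_all add: image_group_carrier)
qed

end

section \<open>Conjugacy classes under a surjective homomorphism\<close>

context group_hom
begin

lemma image_conj_class:
  assumes "h ` carrier G = carrier H" "a \<in> carrier G"
  shows "h ` conj_class G a = conj_class H (h a)"
proof -
  have "h (g \<otimes> a \<otimes> inv g) = h g \<otimes>\<^bsub>H\<^esub> h a \<otimes>\<^bsub>H\<^esub> inv\<^bsub>H\<^esub> (h g)" if "g \<in> carrier G" for g
    using that assms by simp
  hence "h ` conj_class G a = (\<lambda>g. h g \<otimes>\<^bsub>H\<^esub> h a \<otimes>\<^bsub>H\<^esub> inv\<^bsub>H\<^esub> (h g)) ` carrier G"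
    by (simp add: conj_class_def Setcompr_eq_image image_image)
  also have "\<dots> = (\<lambda>x. x \<otimes>\<^bsub>H\<^esub> h a \<otimes>\<^bsub>H\<^esub> inv\<^bsub>H\<^esub> x) ` h ` carrier G"
    by (simp add: image_image)
  also have "\<dots> = conj_class H (h a)"
    by (simp add: assms(1) conj_class_def Setcompr_eq_image)
  finally show ?thesis .
qed

lemma image_mult_inverse_class:
  assumes "h ` carrier G = carrier H" "a \<in> carrier G"
  shows "h ` (conj_class G a <#> conj_class G (inv a)) =
    conj_class H (h a) <#>\<^bsub>H\<^esub> conj_class H (inv\<^bsub>H\<^esub> (h a))"
proof -
  have "h ` (conj_class G a <#> conj_class G (inv a)) =
      h ` conj_class G a <#>\<^bsub>H\<^esub> h ` conj_class G (inv a)"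
    using G.conj_class_in_carrier assms by (intro set_mult_hom[OF homh]) auto
  thus ?thesis using image_conj_class assms by simp
qed

text \<open>Every class in \<open>h ` X\<close> is the image of a class in \<open>X\<close>, so \<open>X\<close> has no fewer classes than
  \<open>h ` X\<close>. The singleton classes of the elements of \<open>T\<close> all map to the class of the identity, so
  they can be left out when the nontrivial classes of \<open>h ` X\<close> are lifted; the \<open>1\<close> on the right
  pays for the trivial class. If \<open>\<one> \<in> X\<close>, then the choice
  \<open>T = {\<one>}\<close> says that \<open>eta\<close> does not grow under \<open>h\<close>.\<close>

lemma eta_image_le:
  assumes surj: "h ` carrier G = carrier H" and fin: "finite (carrier G)"
    and X: "conj_invariant G X"
    and T: "T \<subseteq> X" "T \<subseteq> kernel G H h" "\<And>t g. t \<in> T \<Longrightarrow> g \<in> carrier G \<Longrightarrow> g \<otimes> t = t \<otimes> g"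
  shows "eta H (h ` X) + card T \<le> eta G X + 1"
proof -
  define A where "A = {C \<in> conj_classes G. C \<subseteq> X}"
  define B where "B = {C \<in> conj_classes H. C \<subseteq> h ` X}"
  define S where "S = (\<lambda>t. {t}) ` T"
  have XG: "X \<subseteq> carrier G" using X by (simp add: conj_invariant_def)
  have finA: "finite A" using fin by (simp add: A_def conj_classes_def)
  have TG: "T \<subseteq> carrier G" using XG T by blast
  have SA: "S \<subseteq> A"
  proof
    fix C assume "C \<in> S"
    then obtain t where t: "t \<in> T" "C = {t}" by (auto simp: S_def)
    have "conj_class G t = {t}" using t(1) TG T(3) by (intro G.conj_class_central) auto
    hence "C = conj_class G t" using t(2) by simp
    moreover have "C \<subseteq> X" using t T(1) by blast
    ultimately show "C \<in> A" using t(1) TG by (auto simp: A_def conj_classes_def)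
  qed
  \<comment> \<open>A nontrivial class of the image cannot come from \<open>S\<close>, which is mapped to the identity.\<close>
  have "B - {{\<one>\<^bsub>H\<^esub>}} \<subseteq> (`) h ` (A - S)"
  proof
    fix D assume D: "D \<in> B - {{\<one>\<^bsub>H\<^esub>}}"
    then obtain b where b: "b \<in> carrier H" "D = conj_class H b" "D \<subseteq> h ` X"
      by (auto simp: B_def conj_classes_def)
    then obtain x where x: "x \<in> X" "b = h x" using H.conj_class_self by blast
    have xG: "x \<in> carrier G" using x XG by blast
    have eq: "D = h ` conj_class G x" using image_conj_class[OF surj xG] x b by simp
    have "conj_class G x \<subseteq> X" using X x by (auto simp: conj_invariant_def conj_class_def)
    hence "conj_class G x \<in> A" using xG by (auto simp: A_def conj_classes_def)
    moreover have "conj_class G x \<notin> S"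
      using T(2) eq D by (auto simp: S_def kernel_def)
    ultimately show "D \<in> (`) h ` (A - S)" using eq by blast
  qed
  hence "card (B - {{\<one>\<^bsub>H\<^esub>}}) \<le> card (A - S)"
    using finA by (meson surj_card_le finite_Diff)
  hence "card B - 1 \<le> card A - card S"
    using card_Diff_subset[OF finite_subset[OF SA finA] SA] diff_card_le_card_Diff[of "{{\<one>\<^bsub>H\<^esub>}}" B]
    by simp
  moreover have "card S \<le> card A" using SA finA by (rule card_mono[rotated])
  moreover have "card S = card T" unfolding S_def by (intro card_image) (auto simp: inj_on_def)
  ultimately show ?thesis unfolding eta_def A_def[symmetric] B_def[symmetric] by simp
qed

end

section \<open>Translating a class by central elements\<close>

context group
begin

text \<open>Multiplication by a central \<open>z\<close> commutes with conjugation and so carries the class of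
  \<open>b\<close> into the class of \<open>z b\<close>. Hence \<open>Z\<close> permutes classes, and the set below is the stabilizer
  of the class of \<open>a\<close>.\<close>

lemma subgroup_central_translations:
  assumes Z: "subgroup Z G" and a: "a \<in> carrier G"
    and c: "\<And>z g. z \<in> Z \<Longrightarrow> g \<in> carrier G \<Longrightarrow> g \<otimes> z = z \<otimes> g"
  shows "subgroup {z \<in> Z. z \<otimes> a \<in> conj_class G a} G"
proof -
  interpret Z: subgroup Z G by fact
  have tr: "z \<otimes> x \<in> conj_class G (z \<otimes> b)"
    if zbx: "z \<in> Z" "b \<in> carrier G" "x \<in> conj_class G b" for z b x
  proof -
    obtain g where g: "g \<in> carrier G" "x = g \<otimes> b \<otimes> inv g"
      using zbx by (auto simp: conj_class_def)
    have zc: "z \<in> carrier G" using zbx by simp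
    have "z \<otimes> x = (z \<otimes> g) \<otimes> b \<otimes> inv g" using g zbx zc by (simp add: m_assoc)
    also have "\<dots> = g \<otimes> (z \<otimes> b) \<otimes> inv g"
      using g zbx zc c[OF zbx(1) g(1), symmetric] by (simp add: m_assoc)
    finally show ?thesis using g(1) unfolding conj_class_def by blast
  qed
  show ?thesis
  proof (rule subgroupI)
    have "\<one> \<in> {z \<in> Z. z \<otimes> a \<in> conj_class G a}"
      using a conj_class_self[OF a] by simp
    thus "{z \<in> Z. z \<otimes> a \<in> conj_class G a} \<noteq> {}" by blast
  next
    fix z assume "z \<in> {z \<in> Z. z \<otimes> a \<in> conj_class G a}"
    hence z: "z \<in> Z" "z \<otimes> a \<in> conj_class G a" by auto
    have zc: "z \<in> carrier G" using z by simp
    have "a \<in> conj_class G (z \<otimes> a)"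
      using conj_class_eq[OF a z(2)] conj_class_self[OF a] by simp
    hence "inv z \<otimes> a \<in> conj_class G (inv z \<otimes> (z \<otimes> a))"
      using zc a by (intro tr Z.m_inv_closed z(1)) auto
    moreover have "inv z \<otimes> (z \<otimes> a) = a" using zc a by (metis inv_closed l_inv l_one m_assoc)
    ultimately show "inv z \<in> {z \<in> Z. z \<otimes> a \<in> conj_class G a}" using z by simp
  next
    fix y z assume "y \<in> {z \<in> Z. z \<otimes> a \<in> conj_class G a}" "z \<in> {z \<in> Z. z \<otimes> a \<in> conj_class G a}"
    hence z: "y \<in> Z" "y \<otimes> a \<in> conj_class G a" "z \<in> Z" "z \<otimes> a \<in> conj_class G a" by auto
    have "y \<otimes> (z \<otimes> a) \<in> conj_class G (y \<otimes> a)" using tr z a by blast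
    hence "y \<otimes> (z \<otimes> a) \<in> conj_class G a" using conj_class_eq[OF a z(2)] by simp
    thus "y \<otimes> z \<in> {z \<in> Z. z \<otimes> a \<in> conj_class G a}" using z a by (simp add: m_assoc)
  qed (use Z.subset in auto)
qed

lemma subgroup_of_prime_card:
  assumes "prime (card Z)" "subgroup Z G" "subgroup T G" "T \<subseteq> Z"
  shows "T = {\<one>} \<or> T = Z"
proof -
  have fin: "finite Z" using assms(1) by (metis card.infinite not_prime_0)
  have "card T dvd order (G\<lparr>carrier := Z\<rparr>)"
    using group.lagrange[OF subgroup_imp_group[OF assms(2)] subgroup_incl[OF assms(3,2,4)]]
    by (metis dvd_triv_right)
  hence "card T = 1 \<or> card T = card Z" using assms(1) by (auto simp: order_def prime_nat_iff)
  moreover have "T = {\<one>}" if "card T = 1"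
    using that subgroup.one_closed[OF assms(3)] by (auto simp: card_1_singleton_iff)
  ultimately show ?thesis using card_subset_eq[OF fin assms(4)] by blast
qed

end

context group_hom
begin

text \<open>Two elements of the class of \<open>a\<close> with the same image differ by an element of the kernel,
  which is central and therefore lies in the stabilizer of the whole class. So every fibre of
  \<open>h\<close> on the class is a translate of this stabilizer.\<close>

lemma card_conj_class_of_kernel_translations:
  assumes surj: "h ` carrier G = carrier H" and fin: "finite (carrier G)" and a: "a \<in> carrier G"
    and c: "\<And>z g. z \<in> kernel G H h \<Longrightarrow> g \<in> carrier G \<Longrightarrow> g \<otimes> z = z \<otimes> g"
  shows "card (conj_class G a) =
    card {z \<in> kernel G H h. z \<otimes> a \<in> conj_class G a} * card (conj_class H (h a))"
proof -
  define T where "T = {z \<in> kernel G H h. z \<otimes> a \<in> conj_class G a}"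
  have KG: "kernel G H h \<subseteq> carrier G" by (auto simp: kernel_def)
  have CG: "conj_class G a \<subseteq> carrier G" using G.conj_class_in_carrier a by simp
  \<comment> \<open>With \<open>b\<close> a point of the fibre over \<open>y\<close>, the fibre is the set of all \<open>z \<otimes> b\<close> with \<open>z \<in> T\<close>.\<close>
  have "card {x \<in> conj_class G a. h x = y} = card T" if y: "y \<in> h ` conj_class G a" for y
  proof -
    obtain g where g: "g \<in> carrier G" "y = h (g \<otimes> a \<otimes> inv g)"
      using y by (auto simp: conj_class_def)
    define b where "b = g \<otimes> a \<otimes> inv g"
    have b: "b \<in> carrier G" using a g by (simp add: b_def)
    have mv: "z \<otimes> b = g \<otimes> (z \<otimes> a) \<otimes> inv g" if "z \<in> kernel G H h" for z
    proof -
      have zc: "z \<in> carrier G" using that KG by blast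
      have "z \<otimes> b = (z \<otimes> g) \<otimes> a \<otimes> inv g" using g a zc by (simp add: b_def G.m_assoc)
      also have "\<dots> = (g \<otimes> z) \<otimes> a \<otimes> inv g" using c[OF that g(1)] by simp
      finally show ?thesis using g a zc by (simp add: G.m_assoc)
    qed
    have iff: "z \<otimes> b \<in> conj_class G a \<longleftrightarrow> z \<otimes> a \<in> conj_class G a" if "z \<in> kernel G H h" for z
    proof
      have zc: "z \<in> carrier G" using that KG by blast
      assume "z \<otimes> b \<in> conj_class G a"
      from G.conj_class_closed[OF a this, of "inv g"]
      show "z \<otimes> a \<in> conj_class G a"
        using mv[OF that] g a zc G.conj_conj[of "inv g" g "z \<otimes> a"] by simp
    next
      assume "z \<otimes> a \<in> conj_class G a"
      thus "z \<otimes> b \<in> conj_class G a" using mv[OF that] G.conj_class_closed[OF a _ g(1)] by simp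
    qed
    have "{x \<in> conj_class G a. h x = y} = (\<lambda>z. z \<otimes> b) ` T"
    proof (intro equalityI subsetI)
      fix x assume "x \<in> {x \<in> conj_class G a. h x = y}"
      hence x: "x \<in> conj_class G a" "h x = h b" using g by (auto simp: b_def)
      have xG: "x \<in> carrier G" using x CG by blast
      have "x \<otimes> inv b \<in> kernel G H h" using x xG b by (simp add: kernel_def)
      moreover have xe: "x = (x \<otimes> inv b) \<otimes> b" using xG b by (simp add: G.m_assoc)
      ultimately have "x \<otimes> inv b \<in> T" using iff[of "x \<otimes> inv b"] x(1)
        unfolding T_def by (metis (no_types, lifting) mem_Collect_eq)
      thus "x \<in> (\<lambda>z. z \<otimes> b) ` T" using xe by blast
    next
      fix x assume "x \<in> (\<lambda>z. z \<otimes> b) ` T"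
      then obtain z where z: "z \<in> kernel G H h" "z \<otimes> a \<in> conj_class G a" "x = z \<otimes> b"
        by (auto simp: T_def)
      have "h x = y" using z g b by (simp add: kernel_def b_def[symmetric])
      thus "x \<in> {x \<in> conj_class G a. h x = y}" using z iff by simp
    qed
    moreover have "inj_on (\<lambda>z. z \<otimes> b) T"
      using KG b by (intro inj_onI) (auto simp: T_def dest!: subsetD[OF KG])
    ultimately show ?thesis by (simp add: card_image)
  qed
  moreover have "finite (conj_class G a)" using CG fin finite_subset by blast
  ultimately have "card (conj_class G a) = (\<Sum>y\<in>h ` conj_class G a. card T)"
    using sum.image_gen[of "conj_class G a" "\<lambda>_. 1::nat" h] by simp
  thus ?thesis using image_conj_class[OF surj a] by (simp add: T_def)
qed

text \<open>The induction step. The hypothesis \<open>quot\<close> is the bound for the image, stated for all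
  exponents because the class of \<open>h a\<close> has size \<open>p ^ n\<close> or \<open>p ^ (n - 1)\<close>, according to whether
  the translations by the kernel that fix the class of \<open>a\<close> are trivial or all of them.\<close>

lemma eta_lower_bound_lift:
  assumes surj: "h ` carrier G = carrier H" and fin: "finite (carrier G)" and a: "a \<in> carrier G"
    and c: "\<And>z g. z \<in> kernel G H h \<Longrightarrow> g \<in> carrier G \<Longrightarrow> g \<otimes> z = z \<otimes> g"
    and p: "prime p" "card (kernel G H h) = p"
    and n: "card (conj_class G a) = p ^ n"
    and quot: "\<And>m. card (conj_class H (h a)) = p ^ m \<Longrightarrow>
      m * (p - 1) + 1 \<le> eta H (conj_class H (h a) <#>\<^bsub>H\<^esub> conj_class H (inv\<^bsub>H\<^esub> (h a)))"
  shows "n * (p - 1) + 1 \<le> eta G (conj_class G a <#> conj_class G (inv a))"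
proof -
  define P where "P = conj_class G a <#> conj_class G (inv a)"
  define T where "T = {z \<in> kernel G H h. z \<otimes> a \<in> conj_class G a}"
  have inv: "conj_invariant G P"
    unfolding P_def using a by (intro G.conj_invariant_mult_conj_class) auto
  have "T = {\<one>} \<or> T = kernel G H h"
    unfolding T_def using p subgroup_kernel
    by (intro G.subgroup_of_prime_card G.subgroup_central_translations a c) auto
  have TP: "T \<subseteq> P"
  proof
    fix z assume z: "z \<in> T"
    hence zc: "z \<in> carrier G" by (simp add: T_def kernel_def)
    have "z = (z \<otimes> a) \<otimes> inv a" using a zc by (simp add: G.m_assoc)
    thus "z \<in> P" using z G.conj_class_self[of "inv a"] a
      unfolding P_def set_mult_def T_def by blast
  qed
  have "eta H (h ` P) + card T \<le> eta G P + 1"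
    using c by (intro eta_image_le[OF surj fin inv TP]) (auto simp: T_def)
  hence le: "eta H (conj_class H (h a) <#>\<^bsub>H\<^esub> conj_class H (inv\<^bsub>H\<^esub> (h a))) + card T \<le> eta G P + 1"
    using image_mult_inverse_class[OF surj a] by (simp add: P_def)
  have card: "p ^ n = card T * card (conj_class H (h a))"
    using card_conj_class_of_kernel_translations[OF surj fin a c] n by (simp add: T_def)
  from \<open>T = {\<one>} \<or> T = kernel G H h\<close> show ?thesis
  proof
    assume "T = {\<one>}"
    thus ?thesis using card le quot[of n] by (simp add: P_def)
  next
    assume "T = kernel G H h"
    hence T: "card T = p" using p by simp
    have "n \<noteq> 0"
      using card T p prime_gt_1_nat[OF p(1)] by (intro notI) simp
    then obtain m where m: "n = Suc m" by (cases n) auto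
    have "card (conj_class H (h a)) = p ^ m"
      using card T m p(1) prime_gt_0_nat[OF p(1)] by simp
    from quot[OF this] le T m show ?thesis
      using prime_gt_1_nat[OF p(1)] by (simp add: P_def)
  qed
qed

end

section \<open>The lower bound\<close>

lemma eta_lower_bound_monoid:
  fixes G :: "'a monoid"
  assumes p: "prime p" and "group G" "order G = p ^ k" "a \<in> carrier G"
    "card (conj_class G a) = p ^ n"
  shows "n * (p - 1) + 1 \<le> eta G (conj_class G a <#>\<^bsub>G\<^esub> conj_class G (inv\<^bsub>G\<^esub> a))"
  using assms(2-)
proof (induction k arbitrary: G a n)
  case 0
  interpret group G by fact
  obtain e where "carrier G = {e}"
    using 0(2) by (auto simp: order_def card_1_singleton_iff)
  hence e: "carrier G = {\<one>\<^bsub>G\<^esub>}" using one_closed by auto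
  hence a: "a = \<one>\<^bsub>G\<^esub>" using 0 by auto
  have "p ^ n = 1" using 0(4) a conj_class_one by simp
  hence "n = 0" using prime_gt_1_nat[OF p] by (metis nat_power_eq_Suc_0_iff One_nat_def less_irrefl)
  have "conj_classes G = {{\<one>\<^bsub>G\<^esub>}}" by (simp add: conj_classes_def e conj_class_one)
  hence "eta G {\<one>\<^bsub>G\<^esub>} = 1" using eta_Union[of "{{\<one>\<^bsub>G\<^esub>}}"] by simp
  thus ?case using a \<open>n = 0\<close> by (simp add: conj_class_one set_mult_def)
next
  case (Suc k)
  interpret group G by fact
  have fin: "finite (carrier G)"
    using Suc.prems(2) p order_gt_0_iff_finite prime_gt_0_nat by simp
  obtain Z where Z: "subgroup Z G" "card Z = p" "\<forall>z\<in>Z. \<forall>g\<in>carrier G. g \<otimes>\<^bsub>G\<^esub> z = z \<otimes>\<^bsub>G\<^esub> g"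
    using ex_central_subgroup_of_prime_order[OF p Suc.prems(2)] by blast
  have "g \<otimes>\<^bsub>G\<^esub> z \<otimes>\<^bsub>G\<^esub> inv\<^bsub>G\<^esub> g = z" if zg: "z \<in> Z" "g \<in> carrier G" for z g
  proof -
    have "z \<in> carrier G" using subgroup.mem_carrier[OF Z(1)] zg by simp
    moreover have "g \<otimes>\<^bsub>G\<^esub> z = z \<otimes>\<^bsub>G\<^esub> g" using Z(3) zg by blast
    ultimately show ?thesis using zg by (simp add: m_assoc)
  qed
  hence "Z \<lhd> G" using Z(1) by (simp add: normal_inv_iff)
  then obtain H :: "'a monoid" and h where
    H: "group_hom G H h" "h ` carrier G = carrier H" "kernel G H h = Z"
    by (rule ex_quotient_on_same_type)
  interpret h: group_hom G H h by fact
  have "card (carrier (G Mod Z)) = card (carrier H)"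
    using h.FactGroup_iso_set[OF H(2)] H(3) by (auto simp: iso_def dest: bij_betw_same_card)
  hence "order H * p = p ^ Suc k"
    using lagrange[OF Z(1)] Z(2) Suc.prems(2) by (simp add: order_def FactGroup_def)
  hence "order H = p ^ k" using prime_gt_0_nat[OF p] by simp
  hence quot: "m * (p - 1) + 1 \<le> eta H (conj_class H (h a) <#>\<^bsub>H\<^esub> conj_class H (inv\<^bsub>H\<^esub> h a))"
    if "card (conj_class H (h a)) = p ^ m" for m
    using Suc.IH[of H "h a" m] that Suc.prems(3) h.H.is_group by simp
  show ?case
    using Z H by (intro h.eta_lower_bound_lift[OF H(2) fin Suc.prems(3) _ p _ Suc.prems(4) quot]) auto
qed

text \<open>The induction above runs over groups without additional record fields. Dividing \<open>G\<close> by the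
  trivial subgroup yields an isomorphic group of that form.\<close>

theorem theoremA:
  fixes G :: "('a, 'b) monoid_scheme" and p k n :: nat and a :: 'a
  assumes "prime p"
    and "group G"
    and "order G = p ^ k"
    and "a \<in> carrier G"
    and "card (conj_class G a) = p ^ n"
  shows "eta G (conj_class G a <#>\<^bsub>G\<^esub> conj_class G (inv\<^bsub>G\<^esub> a)) \<ge> n * (p - 1) + 1"
proof -
  interpret group G by fact
  have fin: "finite (carrier G)"
    using assms order_gt_0_iff_finite prime_gt_0_nat by simp
  obtain H :: "'a monoid" and h where
    H: "group_hom G H h" "h ` carrier G = carrier H" "kernel G H h = {\<one>\<^bsub>G\<^esub>}"
    using ex_quotient_on_same_type[OF one_is_normal] by metis
  interpret h: group_hom G H h by fact
  have inj: "inj_on h (carrier G)" using H(3) h.inj_iff_trivial_ker by simp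
  have ordH: "order H = p ^ k"
    using assms(3) card_image[OF inj] H(2) by (simp add: order_def)
  have cardH: "card (conj_class H (h a)) = p ^ n"
    using card_image[OF inj_on_subset[OF inj conj_class_in_carrier[OF assms(4)]]]
      h.image_conj_class[OF H(2) assms(4)] assms(5) by simp
  have "n * (p - 1) + 1 \<le> eta H (conj_class H (h a) <#>\<^bsub>H\<^esub> conj_class H (inv\<^bsub>H\<^esub> h a))"
    by (rule eta_lower_bound_monoid[OF assms(1) h.H.is_group ordH h.hom_closed[OF assms(4)] cardH])
  also have "\<dots> = eta H (h ` (conj_class G a <#>\<^bsub>G\<^esub> conj_class G (inv\<^bsub>G\<^esub> a)))"
    using h.image_mult_inverse_class[OF H(2) assms(4)] by simp
  also have "\<dots> \<le> eta G (conj_class G a <#>\<^bsub>G\<^esub> conj_class G (inv\<^bsub>G\<^esub> a))"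
  proof -
    have "a \<otimes>\<^bsub>G\<^esub> inv\<^bsub>G\<^esub> a \<in> conj_class G a <#>\<^bsub>G\<^esub> conj_class G (inv\<^bsub>G\<^esub> a)"
      unfolding set_mult_def
      using conj_class_self[OF assms(4)] conj_class_self[OF inv_closed[OF assms(4)]] by blast
    hence "\<one>\<^bsub>G\<^esub> \<in> conj_class G a <#>\<^bsub>G\<^esub> conj_class G (inv\<^bsub>G\<^esub> a)"
      using assms(4) by simp
    thus ?thesis
      using h.eta_image_le[OF H(2) fin conj_invariant_mult_conj_class[OF assms(4)],
          of "inv\<^bsub>G\<^esub> a" "{\<one>\<^bsub>G\<^esub>}"] assms(4) H(3) by simp
  qed
  finally show ?thesis .
qed

end
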